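(* Let $(K,v_0)$ and $(L,w_0)$ be abstract simplicial complexes with base vertices which have the same pointed strong homotopy type. Then $\mathrm{scat}^{\mathrm{Wh}}K=\mathrm{scat}^{\mathrm{Wh}}L$.
   Context: Two simplicial maps $\varphi,\psi\colon K\to L$ between abstract simplicial complexes are contiguous, $\varphi\sim_c\psi$, if for every simplex $\sigma$ of $K$ the set of vertices $\varphi(\sigma)\cup\psi(\sigma)$ is a simplex of $L$. They are in the same contiguity class, $\varphi\sim\psi$, if there is a finite sequence of simplicial maps $\varphi=\varphi_1\sim_c\varphi_2\sim_c\cdots\sim_c\varphi_m=\psi$ from $K$ to $L$. Pointed complexes $(K,v_0)$, $(L,w_0)$ have the same pointed strong homotopy type if there are simplicial maps $\varphi\colon K\to L$ and $\psi\colon L\to K$ with $\psi\circ\varphi\sim 1_K$ and $\varphi\circ\psi\sim1_L$ such that $\varphi$, $\psi$ and all the maps in the sequences of contiguous maps defining these two relations preserve the base points. The categorical product $K\times L$ of abstract simplicial complexes has as vertices the pairs $(v,w)$ of a vertex $v$ of $K$ and a vertex $w$ of $L$; a finite nonempty set $\{(v_1,w_1),\dots,(v_q,w_q)\}$ is a simplex iff $\{v_1,\dots,v_q\}$ is a simplex of $K$ and $\{w_1,\dots,w_q\}$ is a simplex of $L$. $K^n$ is the $n$-fold categorical product, with projections $\pi_j\colon K^n\to K$, and $\Delta\colon K\to K^n$, $\Delta(v)=(v,\dots,v)$, is the diagonal map, which is simplicial. For a complex $K$ with base vertex $v_0$, $n\geq1$ and $j=1,\dots,n$, let $K_j=\pi_j^{-1}(\{v_0\})$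 be the (full) subcomplex of $K^n$ spanned by the vertices whose $j$-th coordinate is $v_0$. The $n$-th fat wedge is the subcomplex $T^nK=K_1\cup\cdots\cup K_n\subset K^n$. We say $\mathrm{scat}^{\mathrm{Wh}}K\leq n$ if there is a simplicial map $\delta\colon K\to T^{n+1}K$ such that $I\circ\delta\sim\Delta$, where $I\colon T^{n+1}K\subset K^{n+1}$ is the inclusion and $\Delta\colon K\to K^{n+1}$ is the diagonal (contiguity class as unpointed maps). $\mathrm{scat}^{\mathrm{Wh}}K$, the simplicial Whitehead category, is the least such $n\ge 0$ ($\infty$ if there is none). *)

theory Defs
  imports Main "HOL-Library.FuncSet" "HOL-Library.Extended_Nat"
begin

text \<open>A complex is represented by its set of simplices, which are finite and nonempty.
  Complexes may be infinite.\<close>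

definition abstract_simplicial_complex :: "'a set set \<Rightarrow> bool" where
  "abstract_simplicial_complex K \<longleftrightarrow>
     (\<forall>\<sigma>\<in>K. finite \<sigma> \<and> \<sigma> \<noteq> {}) \<and>
     (\<forall>\<sigma>\<in>K. \<forall>\<tau>. \<tau> \<subseteq> \<sigma> \<and> \<tau> \<noteq> {} \<longrightarrow> \<tau> \<in> K)"

definition vertices :: "'a set set \<Rightarrow> 'a set" where
  "vertices K = \<Union>K"

definition pointed_complex :: "'a set set \<Rightarrow> 'a \<Rightarrow> bool" where
  "pointed_complex K v\<^sub>0 \<longleftrightarrow> abstract_simplicial_complex K \<and> v\<^sub>0 \<in> vertices K"

text \<open>Maps are total functions on the vertex types. Only their values on vertices matter: two
  simplicial maps that agree on the vertices of \<open>K\<close> are contiguous, hence are identified by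
  every contiguity class below.\<close>

definition simplicial_maps :: "'a set set \<Rightarrow> 'b set set \<Rightarrow> ('a \<Rightarrow> 'b) set" where
  "simplicial_maps K L = {\<phi>. \<forall>\<sigma>\<in>K. \<phi> ` \<sigma> \<in> L}"

definition pointed_simplicial_maps ::
    "'a set set \<Rightarrow> 'a \<Rightarrow> 'b set set \<Rightarrow> 'b \<Rightarrow> ('a \<Rightarrow> 'b) set" where
  "pointed_simplicial_maps K v\<^sub>0 L w\<^sub>0 = {\<phi> \<in> simplicial_maps K L. \<phi> v\<^sub>0 = w\<^sub>0}"

definition contiguous :: "'a set set \<Rightarrow> 'b set set \<Rightarrow> ('a \<Rightarrow> 'b) \<Rightarrow> ('a \<Rightarrow> 'b) \<Rightarrow> bool" where
  "contiguous K L \<phi> \<psi> \<longleftrightarrow> (\<forall>\<sigma>\<in>K. \<phi> ` \<sigma> \<union> \<psi> ` \<sigma> \<in> L)"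

text \<open>A finite sequence of contiguous maps from \<open>\<phi>\<close> to \<open>\<psi>\<close>, all of whose members (both ends
  included) belong to \<open>M\<close>.\<close>

definition contiguity_sequence ::
    "('a \<Rightarrow> 'b) set \<Rightarrow> 'a set set \<Rightarrow> 'b set set \<Rightarrow> ('a \<Rightarrow> 'b) \<Rightarrow> ('a \<Rightarrow> 'b) \<Rightarrow> bool" where
  "contiguity_sequence M K L \<phi> \<psi> \<longleftrightarrow>
     \<phi> \<in> M \<and> \<psi> \<in> M \<and> (\<lambda>f g. f \<in> M \<and> g \<in> M \<and> contiguous K L f g)\<^sup>*\<^sup>* \<phi> \<psi>"

definition same_contiguity_class ::
    "'a set set \<Rightarrow> 'b set set \<Rightarrow> ('a \<Rightarrow> 'b) \<Rightarrow> ('a \<Rightarrow> 'b) \<Rightarrow> bool" where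
  "same_contiguity_class K L = contiguity_sequence (simplicial_maps K L) K L"

definition same_pointed_contiguity_class ::
    "'a set set \<Rightarrow> 'a \<Rightarrow> 'b set set \<Rightarrow> 'b \<Rightarrow> ('a \<Rightarrow> 'b) \<Rightarrow> ('a \<Rightarrow> 'b) \<Rightarrow> bool" where
  "same_pointed_contiguity_class K v\<^sub>0 L w\<^sub>0 =
     contiguity_sequence (pointed_simplicial_maps K v\<^sub>0 L w\<^sub>0) K L"

definition same_pointed_strong_homotopy_type ::
    "'a set set \<Rightarrow> 'a \<Rightarrow> 'b set set \<Rightarrow> 'b \<Rightarrow> bool" where
  "same_pointed_strong_homotopy_type K v\<^sub>0 L w\<^sub>0 \<longleftrightarrow>
     (\<exists>\<phi>\<in>pointed_simplicial_maps K v\<^sub>0 L w\<^sub>0. \<exists>\<psi>\<in>pointed_simplicial_maps L w\<^sub>0 K v\<^sub>0.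
        same_pointed_contiguity_class K v\<^sub>0 K v\<^sub>0 (\<psi> \<circ> \<phi>) id \<and>
        same_pointed_contiguity_class L w\<^sub>0 L w\<^sub>0 (\<phi> \<circ> \<psi>) id)"

text \<open>The vertices of the categorical power are the \<open>n\<close>-tuples of vertices, encoded as
  extensional functions on \<open>{1..n}\<close>; the \<open>j\<close>-th projection is evaluation at \<open>j\<close>.\<close>

definition proj :: "nat \<Rightarrow> (nat \<Rightarrow> 'a) \<Rightarrow> 'a" where
  "proj j x = x j"

definition categorical_power :: "nat \<Rightarrow> 'a set set \<Rightarrow> (nat \<Rightarrow> 'a) set set" where
  "categorical_power n K =
     {\<sigma>. finite \<sigma> \<and> \<sigma> \<noteq> {} \<and> \<sigma> \<subseteq> ({1..n} \<rightarrow>\<^sub>E vertices K) \<and> (\<forall>j\<in>{1..n}. proj j ` \<sigma> \<in> K)}"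

definition diagonal :: "nat \<Rightarrow> 'a \<Rightarrow> (nat \<Rightarrow> 'a)" where
  "diagonal n v = (\<lambda>j\<in>{1..n}. v)"

definition full_subcomplex :: "'a set set \<Rightarrow> 'a set \<Rightarrow> 'a set set" where
  "full_subcomplex K V = {\<sigma> \<in> K. \<sigma> \<subseteq> V}"

definition fat_wedge :: "nat \<Rightarrow> 'a set set \<Rightarrow> 'a \<Rightarrow> (nat \<Rightarrow> 'a) set set" where
  "fat_wedge n K v\<^sub>0 =
     (\<Union>j\<in>{1..n}. full_subcomplex (categorical_power n K)
                   {x \<in> vertices (categorical_power n K). proj j x = v\<^sub>0})"

text \<open>The inclusion of the fat wedge into the categorical power is \<open>id\<close> on vertices.\<close>

definition scat_Wh_le :: "'a set set \<Rightarrow> 'a \<Rightarrow> nat \<Rightarrow> bool" where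
  "scat_Wh_le K v\<^sub>0 n \<longleftrightarrow>
     (\<exists>\<delta>\<in>simplicial_maps K (fat_wedge (n + 1) K v\<^sub>0).
        same_contiguity_class K (categorical_power (n + 1) K) (id \<circ> \<delta>) (diagonal (n + 1)))"

text \<open>The infimum of the empty set in \<^typ>\<open>enat\<close> is \<open>\<infinity>\<close>, and a nonempty set of extended
  naturals attains its infimum.\<close>

definition scat_Wh :: "'a set set \<Rightarrow> 'a \<Rightarrow> enat" where
  "scat_Wh K v\<^sub>0 = Inf {enat n | n. scat_Wh_le K v\<^sub>0 n}"

end

theory Submission
  imports Defs
begin

text \<open>If \<open>\<delta>\<close> lifts the diagonal of \<open>K\<close> to the fat wedge up to contiguity, then
  \<open>\<phi>\<^sup>n \<circ> \<delta> \<circ> \<psi>\<close> does so for \<open>L\<close>: it lies in the class of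
  \<open>\<phi>\<^sup>n \<circ> \<Delta> \<circ> \<psi> = \<Delta> \<circ> \<phi> \<circ> \<psi>\<close>, hence in that of \<open>\<Delta>\<close>, and \<open>\<phi>\<^sup>n\<close> preserves the
  fat wedge because \<open>\<phi>\<close> preserves the base point.\<close>

lemma simplicial_maps_comp:
  assumes "f \<in> simplicial_maps K L" and "g \<in> simplicial_maps L M"
  shows "g \<circ> f \<in> simplicial_maps K M"
  using assms unfolding simplicial_maps_def mem_Collect_eq image_comp [symmetric] by blast

text \<open>\<open>F\<close> is applied to every member of the chain. Leaving it arbitrary lets one
  induction serve composition on either side as well as the forgetting of base points.\<close>

lemma contiguity_sequence_map:
  assumes seq: "contiguity_sequence A K L f g"
    and F: "\<And>f. f \<in> A \<Longrightarrow> F f \<in> B"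
    and contig: "\<And>f g. contiguous K L f g \<Longrightarrow> contiguous K' L' (F f) (F g)"
  shows "contiguity_sequence B K' L' (F f) (F g)"
proof -
  have "(\<lambda>f g. f \<in> A \<and> g \<in> A \<and> contiguous K L f g)\<^sup>*\<^sup>* f g"
    using seq by (simp add: contiguity_sequence_def)
  then have "(\<lambda>f g. f \<in> B \<and> g \<in> B \<and> contiguous K' L' f g)\<^sup>*\<^sup>* (F f) (F g)"
    by (induction rule: rtranclp_induct) (auto intro: rtranclp.rtrancl_into_rtrancl F contig)
  then show ?thesis
    using seq F by (simp add: contiguity_sequence_def)
qed

lemma same_contiguity_class_trans:
  assumes "same_contiguity_class K L f g" and "same_contiguity_class K L g h"
  shows "same_contiguity_class K L f h"
  using assms by (auto simp: same_contiguity_class_def contiguity_sequence_def)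

lemma same_contiguity_class_comp_left:
  assumes "same_contiguity_class K L f g" and h: "h \<in> simplicial_maps L M"
  shows "same_contiguity_class K M (h \<circ> f) (h \<circ> g)"
  using assms(1) unfolding same_contiguity_class_def
proof (rule contiguity_sequence_map)
  \<comment> \<open>Images commute with unions, so \<open>h\<close> sends the common simplex of
    \<open>f\<close> and \<open>g\<close> to one of \<open>h \<circ> f\<close> and
    \<open>h \<circ> g\<close>.\<close>
  show "contiguous K M (h \<circ> f) (h \<circ> g)" if "contiguous K L f g" for f g
    using that h
    unfolding contiguous_def simplicial_maps_def image_comp [symmetric] image_Un [symmetric]
    by blast
qed (rule simplicial_maps_comp [OF _ h])

lemma same_contiguity_class_comp_right:
  assumes "same_contiguity_class K L f g" and h: "h \<in> simplicial_maps J K"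
  shows "same_contiguity_class J L (f \<circ> h) (g \<circ> h)"
  using assms(1) unfolding same_contiguity_class_def
proof (rule contiguity_sequence_map)
  show "contiguous J L (f \<circ> h) (g \<circ> h)" if "contiguous K L f g" for f g
    using that h
    unfolding contiguous_def simplicial_maps_def image_comp [symmetric] by blast
qed (rule simplicial_maps_comp [OF h])

text \<open>The Whitehead category compares maps in unpointed classes, so the homotopies are used
  only in this weaker form.\<close>

lemma same_pointed_contiguity_class_imp_same_contiguity_class:
  assumes "same_pointed_contiguity_class K v L w f g"
  shows "same_contiguity_class K L f g"
  using contiguity_sequence_map [where F = "\<lambda>f. f"] assms
  unfolding same_pointed_contiguity_class_def same_contiguity_class_def
    pointed_simplicial_maps_def by blast

lemma simplicial_maps_vertices:
  assumes "f \<in> simplicial_maps K L" and "v \<in> vertices K"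
  shows "f v \<in> vertices L"
  using assms by (auto simp: simplicial_maps_def vertices_def)

text \<open>\<open>compose {1..n} f\<close> is the coordinatewise map. It resets values outside
  \<open>{1..n}\<close> to \<open>undefined\<close>, keeping tuples extensional, which plain
  composition with \<open>f\<close> need not do.\<close>

lemma compose_simplicial_maps_categorical_power:
  assumes f: "f \<in> simplicial_maps K L"
  shows "compose {1..n} f \<in> simplicial_maps (categorical_power n K) (categorical_power n L)"
proof -
  have "compose {1..n} f ` \<sigma> \<in> categorical_power n L" if \<sigma>: "\<sigma> \<in> categorical_power n K" for \<sigma>
  proof -
    have sub: "\<sigma> \<subseteq> ({1..n} \<rightarrow>\<^sub>E vertices K)"
      using \<sigma> by (simp add: categorical_power_def)
    have "compose {1..n} f ` \<sigma> \<subseteq> ({1..n} \<rightarrow>\<^sub>E vertices L)"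
    proof (intro image_subsetI PiE_I)
      fix x j assume x: "x \<in> \<sigma>"
      show "compose {1..n} f x j \<in> vertices L" if "j \<in> {1..n}"
      proof -
        have "x j \<in> vertices K"
          using x that sub by (blast intro: PiE_mem)
        then show ?thesis
          using that f by (simp add: compose_eq simplicial_maps_vertices)
      qed
      show "compose {1..n} f x j = undefined" if "j \<notin> {1..n}"
        using compose_extensional that by (rule extensional_arb)
    qed
    moreover have "proj j ` compose {1..n} f ` \<sigma> \<in> L" if j: "j \<in> {1..n}" for j
    proof -
      have "proj j ` compose {1..n} f ` \<sigma> = f ` proj j ` \<sigma>"
        using j by (simp add: image_image proj_def compose_def)
      then show ?thesis
        using \<sigma> f j by (simp add: categorical_power_def simplicial_maps_def)
    qed
    ultimately show ?thesis
      using \<sigma> by (simp add: categorical_power_def)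
  qed
  then show ?thesis by (simp add: simplicial_maps_def)
qed

text \<open>Vertices of a simplex of the power are vertices of the power, so lying in the j-th
  subcomplex is a condition on one coordinate. The same \<open>j\<close> must serve all vertices of
  the simplex.\<close>

lemma fat_wedge_iff:
  "\<sigma> \<in> fat_wedge n K v \<longleftrightarrow>
     \<sigma> \<in> categorical_power n K \<and> (\<exists>j\<in>{1..n}. \<forall>x\<in>\<sigma>. proj j x = v)"
  by (auto simp: fat_wedge_def full_subcomplex_def vertices_def)

text \<open>The coordinate that is constantly \<open>v\<close> becomes constantly
  \<open>f v = w\<close>, so the same index \<open>j\<close> witnesses membership of the
  image.\<close>

lemma compose_simplicial_maps_fat_wedge:
  assumes "f \<in> pointed_simplicial_maps K v L w"
  shows "compose {1..n} f \<in> simplicial_maps (fat_wedge n K v) (fat_wedge n L w)"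
proof -
  have f: "f \<in> simplicial_maps K L" "f v = w"
    using assms by (auto simp: pointed_simplicial_maps_def)
  have "compose {1..n} f ` \<sigma> \<in> fat_wedge n L w" if \<sigma>: "\<sigma> \<in> fat_wedge n K v" for \<sigma>
  proof -
    obtain j where j: "j \<in> {1..n}" "\<forall>x\<in>\<sigma>. proj j x = v"
      using \<sigma> by (auto simp: fat_wedge_iff)
    then have "\<forall>y\<in>compose {1..n} f ` \<sigma>. proj j y = w"
      using f(2) by (auto simp: proj_def compose_def)
    moreover have "compose {1..n} f ` \<sigma> \<in> categorical_power n L"
      using \<sigma> compose_simplicial_maps_categorical_power [OF f(1)]
      by (auto simp: fat_wedge_iff simplicial_maps_def)
    ultimately show ?thesis
      using j(1) unfolding fat_wedge_iff by blast
  qed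
  then show ?thesis by (simp add: simplicial_maps_def)
qed

lemma diagonal_simplicial_maps:
  assumes "abstract_simplicial_complex K"
  shows "diagonal n \<in> simplicial_maps K (categorical_power n K)"
proof -
  have "diagonal n ` \<sigma> \<in> categorical_power n K" if \<sigma>: "\<sigma> \<in> K" for \<sigma>
  proof -
    have "diagonal n ` \<sigma> \<subseteq> ({1..n} \<rightarrow>\<^sub>E vertices K)"
      using \<sigma> by (auto simp: diagonal_def vertices_def)
    moreover have "proj j ` diagonal n ` \<sigma> = \<sigma>" if "j \<in> {1..n}" for j
      using that by (simp add: image_image proj_def diagonal_def)
    moreover have "finite \<sigma>" "\<sigma> \<noteq> {}"
      using assms \<sigma> by (auto simp: abstract_simplicial_complex_def)
    ultimately show ?thesis
      using \<sigma> by (simp add: categorical_power_def)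
  qed
  then show ?thesis by (simp add: simplicial_maps_def)
qed

text \<open>Naturality of the diagonal. It is an equality of total functions because both sides are
  \<open>undefined\<close> outside \<open>{1..n}\<close>.\<close>

lemma compose_diagonal: "compose {1..n} f \<circ> diagonal n = diagonal n \<circ> f"
  by (auto simp: fun_eq_iff compose_def diagonal_def)

text \<open>One half of a homotopy equivalence, with \<psi> a right inverse of \<phi> up to
  contiguity class, bounds the category of \<open>L\<close> by that of \<open>K\<close>. The base
  point enters through \<phi>, which carries one fat wedge into the other.\<close>

lemma scat_Wh_le_dominated:
  assumes L: "abstract_simplicial_complex L"
    and \<phi>: "\<phi> \<in> pointed_simplicial_maps K v L w"
    and \<psi>: "\<psi> \<in> simplicial_maps L K"
    and \<phi>\<psi>: "same_contiguity_class L L (\<phi> \<circ> \<psi>) id"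
    and K: "scat_Wh_le K v n"
  shows "scat_Wh_le L w n"
proof -
  let ?P = "categorical_power (n + 1) L" and ?\<phi> = "compose {1..n + 1} \<phi>"
  obtain \<delta> where \<delta>: "\<delta> \<in> simplicial_maps K (fat_wedge (n + 1) K v)"
    "same_contiguity_class K (categorical_power (n + 1) K) \<delta> (diagonal (n + 1))"
    using K by (auto simp: scat_Wh_le_def)
  have \<phi>': "\<phi> \<in> simplicial_maps K L"
    using \<phi> by (simp add: pointed_simplicial_maps_def)
  have "same_contiguity_class L ?P (?\<phi> \<circ> (\<delta> \<circ> \<psi>)) (?\<phi> \<circ> (diagonal (n + 1) \<circ> \<psi>))"
    by (intro same_contiguity_class_comp_left [OF same_contiguity_class_comp_right [OF \<delta>(2) \<psi>]]
        compose_simplicial_maps_categorical_power \<phi>')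
  moreover have "?\<phi> \<circ> (diagonal (n + 1) \<circ> \<psi>) = diagonal (n + 1) \<circ> (\<phi> \<circ> \<psi>)"
    by (simp only: comp_assoc [symmetric] compose_diagonal)
  moreover have "same_contiguity_class L ?P (diagonal (n + 1) \<circ> (\<phi> \<circ> \<psi>)) (diagonal (n + 1) \<circ> id)"
    by (intro same_contiguity_class_comp_left [OF \<phi>\<psi>] diagonal_simplicial_maps L)
  \<comment> \<open>The leading \<open>id\<close> is the inclusion of the fat wedge of
    \<open>L\<close>, restored to match the definition.\<close>
  ultimately have "same_contiguity_class L ?P (id \<circ> (?\<phi> \<circ> (\<delta> \<circ> \<psi>))) (diagonal (n + 1))"
    by (simp only: id_comp comp_id) (rule same_contiguity_class_trans)
  moreover have "?\<phi> \<circ> (\<delta> \<circ> \<psi>) \<in> simplicial_maps L (fat_wedge (n + 1) L w)"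
    by (intro simplicial_maps_comp [OF simplicial_maps_comp [OF \<psi> \<delta>(1)]]
        compose_simplicial_maps_fat_wedge [OF \<phi>])
  ultimately show ?thesis
    unfolding scat_Wh_le_def by blast
qed

theorem proposition6p3p1:
  fixes K :: "'a set set" and v\<^sub>0 :: 'a and L :: "'b set set" and w\<^sub>0 :: 'b
  assumes "pointed_complex K v\<^sub>0"
    and "pointed_complex L w\<^sub>0"
    and "same_pointed_strong_homotopy_type K v\<^sub>0 L w\<^sub>0"
  shows "scat_Wh K v\<^sub>0 = scat_Wh L w\<^sub>0"
proof -
  have K: "abstract_simplicial_complex K" and L: "abstract_simplicial_complex L"
    using assms(1,2) by (simp_all add: pointed_complex_def)
  obtain \<phi> \<psi> where \<phi>: "\<phi> \<in> pointed_simplicial_maps K v\<^sub>0 L w\<^sub>0"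
    and \<psi>: "\<psi> \<in> pointed_simplicial_maps L w\<^sub>0 K v\<^sub>0"
    and "same_pointed_contiguity_class K v\<^sub>0 K v\<^sub>0 (\<psi> \<circ> \<phi>) id"
    and "same_pointed_contiguity_class L w\<^sub>0 L w\<^sub>0 (\<phi> \<circ> \<psi>) id"
    using assms(3) by (auto simp: same_pointed_strong_homotopy_type_def)
  then have "same_contiguity_class K K (\<psi> \<circ> \<phi>) id" "same_contiguity_class L L (\<phi> \<circ> \<psi>) id"
    by (blast intro: same_pointed_contiguity_class_imp_same_contiguity_class)+
  moreover have "\<phi> \<in> simplicial_maps K L" "\<psi> \<in> simplicial_maps L K"
    using \<phi> \<psi> by (simp_all add: pointed_simplicial_maps_def)
  \<comment> \<open>The domination lemma is used twice with the roles of \<phi> and \<psi>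
    exchanged. The two infima are then over the same set, which also covers the infinite
    case.\<close>
  ultimately have "scat_Wh_le K v\<^sub>0 n \<longleftrightarrow> scat_Wh_le L w\<^sub>0 n" for n
    using scat_Wh_le_dominated [OF L \<phi>] scat_Wh_le_dominated [OF K \<psi>] by blast
  then show ?thesis by (simp add: scat_Wh_def)
qed

end
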